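(* Let $n,s,k$ be integers with $k\ge 1$ and $k+2\le s\le n$. Then $p^s_{n;\le s;k+1}=p^1_{n;\le s;k}$.
   Context: Parking model: there are $n$ parking spaces in a line, numbered $1,\dots,n$. A preference set of length $n$ is a sequence $(a_1,\dots,a_n)$ of integers with $1\le a_i\le n$; cars $1,\dots,n$ arrive in order, car $i$ parks in the first unoccupied space numbered $\ge a_i$ if one exists, otherwise it fails to park. It is a $k$-flaw preference set if exactly $k$ cars fail to park. $p^l_{n;\le s;k}$ denotes the number of $k$-flaw preference sets $(a_1,\dots,a_n)$ with $n$ spaces such that $a_i\le s$ for all $i$ and $a_1=l$. *)

theory Defs
  imports Main
begin

definition preference_set :: "nat \<Rightarrow> nat list \<Rightarrow> bool" where
  "preference_set n as \<longleftrightarrow> length as = n \<and> set as \<subseteq> {1..n}"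

definition available :: "nat \<Rightarrow> nat set \<Rightarrow> nat \<Rightarrow> nat set" where
  "available n occ a = {j. a \<le> j \<and> j \<le> n \<and> j \<notin> occ}"

(* occ is the set of spaces occupied so far; a car that fails to park leaves it unchanged *)
fun failures :: "nat \<Rightarrow> nat set \<Rightarrow> nat list \<Rightarrow> nat" where
  "failures n occ [] = 0"
| "failures n occ (a # as) =
     (if available n occ a = {} then Suc (failures n occ as)
      else failures n (insert (Min (available n occ a)) occ) as)"

definition flaw_preference_set :: "nat \<Rightarrow> nat \<Rightarrow> nat list \<Rightarrow> bool" where
  "flaw_preference_set k n as \<longleftrightarrow> preference_set n as \<and> failures n {} as = k"

(* num_pref n s k l is p^l_{n;<=s;k}; a_1 is the head of the list *)
definition num_pref :: "nat \<Rightarrow> nat \<Rightarrow> nat \<Rightarrow> nat \<Rightarrow> nat" where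
  "num_pref n s k l =
     card {as. flaw_preference_set k n as \<and> (\<forall>a \<in> set as. a \<le> s) \<and> as \<noteq> [] \<and> hd as = l}"

lemma finite_flaw_preference_sets: "finite {as. flaw_preference_set k n as}"
  by (rule finite_subset[OF _ finite_lists_length_eq[of "{1..n}" n]])
     (auto simp: flaw_preference_set_def preference_set_def)

end

theory Submission
  imports Defs
begin

text \<open>
  At most \<open>k\<close> cars fail iff for every \<open>j\<close> the number of cars preferring a space \<open>\<ge> j\<close> exceeds
  the number of free spaces \<open>\<ge> j\<close> by at most \<open>k\<close>. For preferences bounded by \<open>s\<close>, replacing a
  first preference \<open>1\<close> by \<open>s\<close> raises the left-hand count by one exactly for \<open>2 \<le> j \<le> s\<close>, while for
  the remaining \<open>j\<close> the condition holds automatically. Hence the replacement raises a positive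
  number of failures by exactly one, and it is the required bijection.
\<close>

lemma finite_available: "finite (available n occ a)"
  by (rule finite_subset[of _ "{..n}"]) (auto simp: available_def)

lemma length_filter_ge_antimono:
  fixes i j :: "'a :: preorder"
  assumes "i \<le> j"
  shows "length (filter ((\<le>) j) xs) \<le> length (filter ((\<le>) i) xs)"
  using assms by (induction xs) (auto intro: order_trans)

lemma card_available_insert:
  assumes "m \<in> available n occ a"
  shows "card (available n occ j)
       = card (available n (insert m occ) j) + (if j \<le> m then 1 else 0)"
proof (cases "j \<le> m")
  case True
  then have "available n occ j = insert m (available n (insert m occ) j)"
    using assms by (auto simp: available_def)
  moreover have "m \<notin> available n (insert m occ) j"
    by (simp add: available_def)
  ultimately show ?thesis
    using True finite_available by simp
next
  case False
  then have "available n occ j = available n (insert m occ) j"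
    by (auto simp: available_def)
  with False show ?thesis by simp
qed

lemma available_eq_up_to_Min:
  assumes "available n occ a \<noteq> {}" and "a \<le> j" and "j \<le> Min (available n occ a)"
  shows "available n occ j = available n occ a"
proof -
  have "j \<le> i" if "i \<in> available n occ a" for i
    using assms(3) Min_le[OF finite_available that] by (rule order_trans)
  with assms(2) show ?thesis
    by (force simp: available_def)
qed

text \<open>A deficiency version of Hall's condition, proved by following the first car with
  \<open>occ\<close> and \<open>k\<close> arbitrary. A car that fails uses up one unit of
  \<open>k\<close>. A car that parks in \<open>m\<close> removes one free space from the counts for
  \<open>j \<le> m\<close>, while its preference is counted only for
  \<open>j \<le> a\<close>.\<close>

theorem failures_le_iff:
  "failures n occ as \<le> k \<longleftrightarrow>
     (\<forall>j. length (filter ((\<le>) j) as) \<le> card (available n occ j) + k)"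
proof (induction as arbitrary: occ k)
  case Nil
  show ?case by simp
next
  case (Cons a as)
  let ?c = "\<lambda>j. length (filter ((\<le>) j) as)"
  let ?f = "\<lambda>j. card (available n occ j)"
  have c_anti: "?c j \<le> ?c a" if "a \<le> j" for j
    using that by (rule length_filter_ge_antimono)
  have split: "(\<forall>j. length (filter ((\<le>) j) (a # as)) \<le> ?f j + k) \<longleftrightarrow>
      (\<forall>j. ?c j + (if j \<le> a then 1 else 0) \<le> ?f j + k)"
    by (intro all_cong1) simp
  show ?case
  proof (cases "available n occ a = {}")
    case True
    show ?thesis
    proof (cases k)
      case 0
      \<comment> \<open>The condition is violated at \<open>j = a\<close>: the first car is counted
        there, but no space from \<open>a\<close> on is free.\<close>
      with True show ?thesis
        by (auto intro!: exI[of _ a])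
    next
      case (Suc k')
      have "(\<forall>j. ?c j \<le> ?f j + k') \<longleftrightarrow>
          (\<forall>j. ?c j + (if j \<le> a then 1 else 0) \<le> ?f j + k)" (is "?L \<longleftrightarrow> ?R")
      proof
        assume ?L
        then show ?R by (simp add: Suc le_SucI)
      next
        assume R: ?R
        show ?L
        proof
          fix j
          \<comment> \<open>No free space from \<open>a\<close> on means \<open>?f a = 0\<close>.
            This bound settles all \<open>j > a\<close> by antitonicity; for
            \<open>j \<le> a\<close> the extra \<open>1\<close> cancels against
            \<open>k = Suc k'\<close>.\<close>
          have "?c a \<le> k'"
            using spec[OF R, of a] True Suc by simp
          then show "?c j \<le> ?f j + k'"
            using spec[OF R, of j] c_anti[of j] Suc by (cases "j \<le> a") auto
        qed
      qed
      then show ?thesis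
        unfolding split using True Suc Cons.IH[of occ k'] by simp
    qed
  next
    case False
    define m where "m = Min (available n occ a)"
    have m: "m \<in> available n occ a"
      unfolding m_def using False finite_available by (rule Min_in[rotated])
    then have "a \<le> m" by (simp add: available_def)
    have f_eq: "?f j = card (available n (insert m occ) j) + (if j \<le> m then 1 else 0)" for j
      using m by (rule card_available_insert)
    have "(\<forall>j. ?c j \<le> card (available n (insert m occ) j) + k) \<longleftrightarrow>
        (\<forall>j. ?c j + (if j \<le> a then 1 else 0) \<le> ?f j + k)" (is "?L \<longleftrightarrow> ?R")
    proof
      assume L: ?L
      show ?R
      proof
        fix j
        show "?c j + (if j \<le> a then 1 else 0) \<le> ?f j + k"
          \<comment> \<open>Since \<open>a \<le> m\<close>, the space \<open>m\<close> pays for the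
            first car whenever that car is counted.\<close>
          using spec[OF L, of j] f_eq[of j] \<open>a \<le> m\<close> by auto
      qed
    next
      assume R: ?R
      show ?L
      proof
        fix j
        \<comment> \<open>Spaces \<open>a..<m\<close> are occupied, so for \<open>a < j \<le> m\<close> the condition at \<open>j\<close> follows from that at \<open>a\<close>.\<close>
        have "?f j = ?f a" if "a \<le> j" "j \<le> m"
          using available_eq_up_to_Min[OF False that(1) that(2)[unfolded m_def]] by (rule arg_cong)
        then show "?c j \<le> card (available n (insert m occ) j) + k"
          using spec[OF R, of j] spec[OF R, of a] f_eq[of j] c_anti[of j] \<open>a \<le> m\<close>
          by (cases "j \<le> a"; cases "j \<le> m") auto
      qed
    qed
    then show ?thesis
      unfolding split using False Cons.IH[of "insert m occ" k] by (simp add: m_def)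
  qed
qed

lemma failures_Cons_1_le_iff:
  assumes "length bs < n" and "\<forall>b \<in> set bs. b \<le> s" and "1 \<le> s"
  shows "failures n {} (1 # bs) \<le> k \<longleftrightarrow> failures n {} (s # bs) \<le> k + 1"
proof -
  \<comment> \<open>This includes \<open>j = 0\<close>, where \<open>available\<close> also contains
    the fictitious space \<open>0\<close>; truncated subtraction covers
    \<open>j > n\<close>.\<close>
  have card: "card (available n {} j) = n + 1 - j" for j
  proof -
    have "available n {} j = {j..n}" by (auto simp: available_def)
    then show ?thesis by simp
  qed
  have "length (filter ((\<le>) j) (1 # bs)) \<le> n + 1 - j + k \<longleftrightarrow>
      length (filter ((\<le>) j) (s # bs)) \<le> n + 1 - j + (k + 1)" for j
  proof -
    have lt: "length (filter ((\<le>) j) bs) < n"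
      using length_filter_le assms(1) by (rule le_less_trans)
    have zero: "filter ((\<le>) j) bs = []" if "s < j"
      using that assms(2) by (auto simp: filter_empty_conv)
    consider "j \<le> 1" | "1 < j" "j \<le> s" | "s < j" by linarith
    then show ?thesis
    proof cases
      case 1
      \<comment> \<open>Both sides are true: at most \<open>n\<close> cars face at least
        \<open>n\<close> spaces.\<close>
      with lt assms(3) show ?thesis by auto
    next
      case 2
      then show ?thesis by simp
    next
      case 3
      with zero assms(3) show ?thesis by simp
    qed
  qed
  then show ?thesis
    unfolding failures_le_iff card by blast
qed

text \<open>Equality follows from the bounds at \<open>k\<close> and \<open>k - 1\<close>;
  \<open>1 \<le> k\<close> keeps the subtraction from truncating.\<close>

lemma failures_Cons_1_eq_iff:
  assumes "length bs < n" and "\<forall>b \<in> set bs. b \<le> s" and "1 \<le> s" and "1 \<le> k"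
  shows "failures n {} (1 # bs) = k \<longleftrightarrow> failures n {} (s # bs) = k + 1"
  using failures_Cons_1_le_iff[OF assms(1-3), of k]
    failures_Cons_1_le_iff[OF assms(1-3), of "k - 1"] assms(4) by linarith

text \<open>Removing the fixed first car lets counts for different \<open>l\<close> be compared tail
  by tail.\<close>

lemma num_pref_eq_card_tails:
  assumes "1 \<le> l" and "l \<le> s" and "s \<le> n"
  shows "num_pref n s k l =
    card {bs. length bs = n - 1 \<and> set bs \<subseteq> {1..s} \<and> failures n {} (l # bs) = k}"
    (is "_ = card ?B")
proof -
  have "{as. flaw_preference_set k n as \<and> (\<forall>a \<in> set as. a \<le> s) \<and> as \<noteq> [] \<and> hd as = l}
      = (#) l ` ?B" (is "?A = _")
  proof (intro equalityI subsetI)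
    fix as
    assume "as \<in> ?A"
    moreover from this have "as = l # tl as" by (cases as) auto
    ultimately show "as \<in> (#) l ` ?B"
      by (intro image_eqI[of _ _ "tl as"]; cases as)
         (auto simp: flaw_preference_set_def preference_set_def)
  next
    fix as
    assume "as \<in> (#) l ` ?B"
    then obtain bs where bs: "as = l # bs" "length bs = n - 1" "set bs \<subseteq> {1..s}"
      "failures n {} as = k"
      by auto
    moreover have "{1..s} \<subseteq> {1..n}"
      using assms(3) by simp
    then have "set bs \<subseteq> {1..n}"
      using bs(3) by (rule subset_trans[rotated])
    ultimately show "as \<in> ?A"
      using assms by (auto simp: flaw_preference_set_def preference_set_def simp del: failures.simps)
  qed
  then show ?thesis
    unfolding num_pref_def by (simp add: card_image)
qed

theorem theorem6p3:
  fixes n s k :: nat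
  assumes "1 \<le> k" and "k + 2 \<le> s" and "s \<le> n"
  shows "num_pref n s (k + 1) s = num_pref n s k 1"
proof -
  have "failures n {} (s # bs) = k + 1 \<longleftrightarrow> failures n {} (1 # bs) = k"
    if "length bs = n - 1" and "set bs \<subseteq> {1..s}" for bs
  proof -
    have "length bs < n" and "\<forall>b \<in> set bs. b \<le> s"
      using that assms by auto
    then show ?thesis
      using failures_Cons_1_eq_iff[of bs n s k] assms by simp
  qed
  then have "{bs. length bs = n - 1 \<and> set bs \<subseteq> {1..s} \<and> failures n {} (s # bs) = k + 1}
      = {bs. length bs = n - 1 \<and> set bs \<subseteq> {1..s} \<and> failures n {} (1 # bs) = k}"
    by blast
  then show ?thesis
    using assms by (simp add: num_pref_eq_card_tails)
qed

end
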